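(* Let $n\ge1$ and let $L$ be a closed subset of $\mathbb{C}^n$ with the following two properties: (i) For every $\zeta\in L$ there is an $r_0>0$ such that either $B(\zeta,r_0)\subseteq L$, or for all $r\in(0,r_0)$ there are a point $w\in B(\zeta,r)\setminus L$ and an $(n-1)$-dimensional complex (affine) hyperplane $H$ containing $w$ and disjoint from $B(\zeta,r)\cap L$. (ii) For any product $U=U_1\times\cdots\times U_n$ of domains $U_i\subseteq\mathbb{C}$ and for any point $(z_1,\dots,z_n)\in U\cap L$, the set $\{w\in U_i:(z_1,\dots,z_{i-1},w,z_{i+1},\dots,z_n)\in L\}$ has a limit point in $U_i$ for every $i=1,2,\dots,n$. Then for every given point $\zeta\in L$, the set of functions in $C(L)$ that are not holomorphically extendable at $\zeta$ is a dense $G_\delta$ subset of $C(L)$; likewise, the set of functions in $C(L)$ that are holomorphically extendable at no point of $L$ is a dense $G_\delta$ subset of $C(L)$. In particular, in dimension $n=1$, a sufficient condition for these conclusions is that $L$ be perfect (closed with no isolated points).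
   Context: $B(\zeta,r)$ is the open Euclidean ball in $\mathbb{C}^n$ with center $\zeta$ and radius $r$. A domain is a nonempty open connected set; a limit point of a set is an accumulation point. $C(L)$ is the space of continuous functions $L\to\mathbb{C}$ with the topology given by the seminorms $|f|_N=\sup_{z\in L,\,\|z\|\le N}|f(z)|$, $N\in\mathbb{N}$ (a Fréchet space). A function $f\in C(L)$ is holomorphically extendable at $\zeta\in L$ if there are an open neighborhood $U\subseteq\mathbb{C}^n$ of $\zeta$ and a holomorphic function $F:U\to\mathbb{C}$ such that $F=f$ on $U\cap L$. *)

theory Defs
  imports "HOL-Analysis.Analysis"
begin

text \<open>Holomorphy on an open set of \<open>\<complex>\<^sup>n\<close>: the Frechet derivative exists at every point
  and is complex linear.\<close>

definition holomorphic_Cn_on :: "(complex ^ 'n \<Rightarrow> complex) \<Rightarrow> (complex ^ 'n) set \<Rightarrow> bool"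
  where "holomorphic_Cn_on F U \<longleftrightarrow>
    open U \<and>
    (\<forall>z\<in>U. \<exists>D. (F has_derivative D) (at z) \<and> (\<forall>c h. D (c *s h) = c * D h))"

definition complex_hyperplane :: "(complex ^ 'n) set \<Rightarrow> bool"
  where "complex_hyperplane H \<longleftrightarrow>
    (\<exists>p V. vec.subspace V \<and> vec.dim V = CARD('n) - 1 \<and> H = (\<lambda>v. p + v) ` V)"

text \<open>Functions on \<open>L\<close> are represented by total functions that are \<open>undefined\<close> outside \<open>L\<close>,
  so that equality of representatives is equality on \<open>L\<close>.\<close>

definition cont_space :: "(complex ^ 'n) set \<Rightarrow> (complex ^ 'n \<Rightarrow> complex) set"
  where "cont_space L = {f \<in> extensional L. continuous_on L f}"

text \<open>The inserted \<open>0\<close> only matters when no point of \<open>L\<close> has norm at most \<open>N\<close>; it fixes the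
  convention that the supremum is then \<open>0\<close>.\<close>

definition cont_seminorm ::
    "(complex ^ 'n) set \<Rightarrow> nat \<Rightarrow> (complex ^ 'n \<Rightarrow> complex) \<Rightarrow> real"
  where "cont_seminorm L N f = Sup (insert 0 ((\<lambda>z. norm (f z)) ` {z \<in> L. norm z \<le> real N}))"

definition cont_topology :: "(complex ^ 'n) set \<Rightarrow> (complex ^ 'n \<Rightarrow> complex) topology"
  where "cont_topology L = topology_generated_by
    {{g \<in> cont_space L. cont_seminorm L N (\<lambda>z. g z - f z) < e} | f N e.
      f \<in> cont_space L \<and> e > 0}"

definition dense_gdelta_in :: "'a topology \<Rightarrow> 'a set \<Rightarrow> bool"
  where "dense_gdelta_in X S \<longleftrightarrow> gdelta_in X S \<and> X closure_of S = topspace X"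

definition holomorphically_extendable_at ::
    "(complex ^ 'n) set \<Rightarrow> (complex ^ 'n \<Rightarrow> complex) \<Rightarrow> complex ^ 'n \<Rightarrow> bool"
  where "holomorphically_extendable_at L f \<zeta> \<longleftrightarrow>
    (\<exists>U F. open U \<and> \<zeta> \<in> U \<and> holomorphic_Cn_on F U \<and> (\<forall>z\<in>U \<inter> L. F z = f z))"

lemma topspace_cont_topology: "topspace (cont_topology L) = cont_space L"
proof
  show "topspace (cont_topology L) \<subseteq> cont_space L"
    unfolding cont_topology_def topology_generated_by_topspace by auto
next
  show "cont_space L \<subseteq> topspace (cont_topology L)"
  proof
    fix f assume f: "f \<in> cont_space L"
    let ?B = "{g \<in> cont_space L. cont_seminorm L 0 (\<lambda>z. g z - f z) < 1}"
    have "insert (0::real) ((\<lambda>z. norm (f z - f z)) ` {z \<in> L. norm z \<le> real 0}) = {0}"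
      by auto
    then have "cont_seminorm L 0 (\<lambda>z. f z - f z) = 0"
      unfolding cont_seminorm_def by (simp only: cSup_singleton)
    then have "cont_seminorm L 0 (\<lambda>z. f z - f z) < 1"
      by (simp only: zero_less_one)
    with f have fB: "f \<in> ?B"
      by (intro CollectI conjI)
    have "openin (cont_topology L) ?B"
      unfolding cont_topology_def
      by (rule topology_generated_by_Basis, rule CollectI, intro exI[of _ f] exI[of _ 0] exI[of _ 1] conjI refl f zero_less_one)
    with fB show "f \<in> topspace (cont_topology L)"
      using openin_subset by blast
  qed
qed

end

theory Submission
  imports Defs "HOL-Complex_Analysis.Great_Picard"
begin

text \<open>The set of functions that are extendable at a point \<open>\<zeta>\<close> is shown to be meagre and an
\<open>F\<^sub>\<sigma>\<close> set in the completely metrizable space \<open>C(L)\<close>; the claims are then instances of the Baire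
category theorem.

If \<open>f\<close> is extendable at \<open>\<zeta>\<close>, it has an extension to the ball around \<open>\<zeta>\<close> of radius
\<open>1 / (m + 1)\<close> that is bounded by \<open>m\<close>, for some \<open>m\<close>. Let \<open>A m\<close> be the set of all \<open>f\<close> with such an
extension. By Montel's theorem (\<open>Montel_ball\<close>) every function in the closure of \<open>A m\<close> still extends
to the ball of a quarter of that radius. Hence the extendable functions are the union of the closures
of the sets \<open>A m\<close>. The functions that extend to one fixed ball form a linear space, and a proper linear
subspace of \<open>C(L)\<close> has no interior. So it only remains to find, for every ball around \<open>\<zeta>\<close>, one
continuous function on \<open>L\<close> that does not extend to it (\<open>exists_not_extends_to\<close>).

This is where the geometry of \<open>L\<close> enters. If \<open>L\<close> is a neighbourhood of \<open>\<zeta>\<close>, the conjugate of a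
coordinate will do. Otherwise there are a point \<open>w\<close> close to \<open>\<zeta>\<close> and an affine function that vanishes
at \<open>w\<close> but nowhere on \<open>L\<close> near \<open>\<zeta>\<close>; its reciprocal, continued to \<open>L\<close> by Tietze's theorem, has
no extension. For if \<open>F\<close> were one, then \<open>F\<close> times the affine function would be \<open>1\<close> on \<open>L\<close> near
\<open>\<zeta>\<close>, and so at \<open>w\<close>, because the hypothesis on products of domains makes \<open>L\<close> a set of uniqueness
(\<open>identity_theorem_ball\<close>, which applies the one-variable identity theorem to each coordinate in turn).

For the second claim, a function that is extendable at some point of \<open>L\<close> is extendable at a point
of a countable dense subset of \<open>L\<close>, so countably many meagre sets suffice. In dimension one, both
conditions hold for perfect sets: hyperplanes are points, and the slice of \<open>L\<close> is \<open>L\<close> itself.\<close>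

section \<open>Cauchy estimates and Montel's theorem in several variables\<close>

lemma norm_complex_smult: "norm (c *s x) = norm c * norm (x :: complex ^ 'n)"
  unfolding norm_vec_def by (simp add: norm_mult L2_set_right_distrib)

lemma bounded_linear_complex_line: "bounded_linear (\<lambda>t. t *s (h :: complex ^ 'n))"
proof (rule bounded_linear_intro)
  show "(s + t) *s h = s *s h + t *s h" for s t by (vector distrib_right)
  show "(r *\<^sub>R t) *s h = r *\<^sub>R (t *s h)" for r t by (vector)
  show "norm (t *s h) \<le> norm t * norm h" for t by (simp add: norm_complex_smult)
qed

text \<open>Restriction to complex lines \<open>t \<mapsto> a + t h\<close> reduces every local question below to one complex
variable: by complex linearity the derivative in direction \<open>h\<close> is an ordinary complex derivative.\<close>

lemma has_field_derivative_complex_line: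
  fixes F :: "complex ^ 'n \<Rightarrow> complex"
  assumes D: "(F has_derivative D) (at (a + t *s h))"
    and lin: "\<And>c h. D (c *s h) = c * D h"
  shows "((\<lambda>t. F (a + t *s h)) has_field_derivative D h) (at t)"
proof -
  have "((\<lambda>t. a + t *s h) has_derivative (\<lambda>s. s *s h)) (at t)"
    using bounded_linear.has_derivative[OF bounded_linear_complex_line has_derivative_ident]
    by (auto intro!: derivative_eq_intros)
  from diff_chain_at[OF this D] have "((\<lambda>t. F (a + t *s h)) has_derivative (\<lambda>s. s * D h)) (at t)"
    by (simp add: o_def lin)
  then show ?thesis
    unfolding has_field_derivative_def by (rule has_derivative_eq_rhs) (simp add: fun_eq_iff)
qed

lemma holomorphic_on_complex_line:
  fixes F :: "complex ^ 'n \<Rightarrow> complex"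
  assumes "holomorphic_Cn_on F U" and "\<And>t. t \<in> T \<Longrightarrow> a + t *s h \<in> U"
  shows "(\<lambda>t. F (a + t *s h)) holomorphic_on T"
  unfolding holomorphic_on_def
proof
  fix t assume "t \<in> T"
  with assms obtain D where "(F has_derivative D) (at (a + t *s h))" "\<And>c h. D (c *s h) = c * D h"
    unfolding holomorphic_Cn_on_def by meson
  then show "(\<lambda>t. F (a + t *s h)) field_differentiable at t within T"
    using has_field_derivative_complex_line field_differentiable_at_within field_differentiable_def
    by blast
qed

lemma holomorphic_Cn_on_subset:
  "holomorphic_Cn_on F U \<Longrightarrow> open V \<Longrightarrow> V \<subseteq> U \<Longrightarrow> holomorphic_Cn_on F V"
  unfolding holomorphic_Cn_on_def by blast

lemma holomorphic_Cn_on_cong: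
  assumes "holomorphic_Cn_on F U" "\<And>z. z \<in> U \<Longrightarrow> G z = F z"
  shows "holomorphic_Cn_on G U"
  unfolding holomorphic_Cn_on_def
proof (intro conjI ballI)
  show U: "open U" using assms(1) holomorphic_Cn_on_def by blast
  fix z assume z: "z \<in> U"
  with assms(1) obtain D where "(F has_derivative D) (at z)" "\<forall>c h. D (c *s h) = c * D h"
    unfolding holomorphic_Cn_on_def by meson
  then show "\<exists>D. (G has_derivative D) (at z) \<and> (\<forall>c h. D (c *s h) = c * D h)"
    using has_derivative_transform_within_open[OF _ U z] assms(2) by metis
qed

lemma holomorphic_Cn_on_mult:
  assumes "holomorphic_Cn_on F U" "holomorphic_Cn_on G U"
  shows "holomorphic_Cn_on (\<lambda>z. F z * G z) U"
  unfolding holomorphic_Cn_on_def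
proof (intro conjI ballI)
  show "open U" using assms(1) holomorphic_Cn_on_def by blast
  fix z assume z: "z \<in> U"
  obtain D E where D: "(F has_derivative D) (at z)" "\<forall>c h. D (c *s h) = c * D h"
    and E: "(G has_derivative E) (at z)" "\<forall>c h. E (c *s h) = c * E h"
    using assms z unfolding holomorphic_Cn_on_def by meson
  show "\<exists>D. ((\<lambda>z. F z * G z) has_derivative D) (at z) \<and> (\<forall>c h. D (c *s h) = c * D h)"
    using has_derivative_mult[OF D(1) E(1)] D(2) E(2)
    by (intro exI[of _ "\<lambda>h. F z * E h + D h * G z"]) (auto simp: algebra_simps)
qed

lemma holomorphic_Cn_on_diff:
  assumes "holomorphic_Cn_on F U" "holomorphic_Cn_on G U"
  shows "holomorphic_Cn_on (\<lambda>z. F z - G z) U"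
  unfolding holomorphic_Cn_on_def
proof (intro conjI ballI)
  show "open U" using assms(1) holomorphic_Cn_on_def by blast
  fix z assume z: "z \<in> U"
  obtain D E where D: "(F has_derivative D) (at z)" "\<forall>c h. D (c *s h) = c * D h"
    and E: "(G has_derivative E) (at z)" "\<forall>c h. E (c *s h) = c * E h"
    using assms z unfolding holomorphic_Cn_on_def by meson
  show "\<exists>D. ((\<lambda>z. F z - G z) has_derivative D) (at z) \<and> (\<forall>c h. D (c *s h) = c * D h)"
    using has_derivative_diff[OF D(1) E(1)] D(2) E(2)
    by (intro exI[of _ "\<lambda>h. D h - E h"]) (auto simp: algebra_simps)
qed

lemma holomorphic_Cn_on_const: "open U \<Longrightarrow> holomorphic_Cn_on (\<lambda>z. c) U"
  unfolding holomorphic_Cn_on_def by (auto intro!: exI[of _ "\<lambda>h. 0"])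

text \<open>The disc of radius \<open>s / norm h\<close> in direction \<open>h\<close> stays in the ball of radius \<open>s\<close>, so the
one-variable Cauchy inequality applies on it.\<close>

lemma Cauchy_estimate_Cn:
  fixes F :: "complex ^ 'n \<Rightarrow> complex"
  assumes F: "holomorphic_Cn_on F U" and "cball x s \<subseteq> U" and "0 < s"
    and M: "\<And>y. y \<in> cball x s \<Longrightarrow> norm (F y) \<le> M"
    and D: "(F has_derivative D) (at x)" and lin: "\<And>c h. D (c *s h) = c * D h"
  shows "norm (D h) \<le> M / s * norm h"
proof (cases "h = 0")
  case True
  then show ?thesis using lin[of 0 0] by simp
next
  case False
  define \<rho> where "\<rho> = s / norm h"
  have \<rho>: "0 < \<rho>" using \<open>0 < s\<close> False by (simp add: \<rho>_def)
  have in_cball: "x + t *s h \<in> cball x s" if "norm t \<le> \<rho>" for t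
    using that False by (simp add: dist_norm norm_complex_smult \<rho>_def pos_le_divide_eq)
  let ?\<phi> = "\<lambda>t. F (x + t *s h)"
  have hol: "?\<phi> holomorphic_on cball 0 \<rho>"
    using in_cball assms(2) by (intro holomorphic_on_complex_line[OF F]) auto
  have "norm ((deriv ^^ 1) ?\<phi> 0) \<le> fact 1 * M / \<rho> ^ 1"
  proof (rule Cauchy_inequality)
    show "?\<phi> holomorphic_on ball 0 \<rho>" by (rule holomorphic_on_subset[OF hol]) auto
    show "continuous_on (cball 0 \<rho>) ?\<phi>" by (rule holomorphic_on_imp_continuous_on[OF hol])
    show "norm (F (x + t *s h)) \<le> M" if "norm (0 - t) = \<rho>" for t
      using that by (intro M in_cball) simp
  qed (rule \<rho>)
  moreover have "deriv ?\<phi> 0 = D h"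
    using has_field_derivative_complex_line[of F D x 0 h] D lin by (intro DERIV_imp_deriv) simp
  ultimately show ?thesis
    by (simp add: \<rho>_def)
qed

lemma bounded_holomorphic_Lipschitz:
  fixes F :: "complex ^ 'n \<Rightarrow> complex"
  assumes F: "holomorphic_Cn_on F U" and "convex S" and "0 < s"
    and sub: "\<And>x. x \<in> S \<Longrightarrow> cball x s \<subseteq> U"
    and M: "\<And>y. y \<in> U \<Longrightarrow> norm (F y) \<le> M"
    and "x \<in> S" "y \<in> S"
  shows "norm (F x - F y) \<le> M / s * norm (x - y)"
proof -
  have "S \<subseteq> U" using sub \<open>0 < s\<close> by (meson centre_in_cball less_imp_le subset_iff)
  then obtain D where D: "\<And>z. z \<in> S \<Longrightarrow> (F has_derivative D z) (at z)"
      "\<And>z c h. z \<in> S \<Longrightarrow> D z (c *s h) = c * D z h"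
    using F unfolding holomorphic_Cn_on_def by (metis subsetD)
  show ?thesis
  proof (rule differentiable_bound[OF \<open>convex S\<close>])
    show "(F has_derivative D z) (at z within S)" if "z \<in> S" for z
      using D(1)[OF that] by (rule has_derivative_at_withinI)
    show "onorm (D z) \<le> M / s" if "z \<in> S" for z
      using sub[OF that] M D that \<open>0 < s\<close>
      by (intro onorm_le Cauchy_estimate_Cn[OF F sub[OF that]]) auto
  qed fact+
qed

text \<open>By the Cauchy estimate for \<open>F m - F n\<close>, uniform convergence of the functions makes their derivatives
uniformly Cauchy in operator norm, at the price of a margin \<open>s\<close>. The limit is then differentiable
by the theorem on termwise differentiation.\<close>

lemma holomorphic_Cn_uniform_limit:
  fixes F :: "nat \<Rightarrow> complex ^ 'n \<Rightarrow> complex"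
  assumes F: "\<And>n. holomorphic_Cn_on (F n) U"
    and V: "open V" "convex V" "0 < s" "\<And>x. x \<in> V \<Longrightarrow> cball x s \<subseteq> S" and "S \<subseteq> U"
    and lim: "\<And>e. 0 < e \<Longrightarrow> \<exists>N. \<forall>n x. n \<ge> N \<and> x \<in> S \<longrightarrow> norm (F n x - g x) < e"
  shows "holomorphic_Cn_on g V"
proof (cases "V = {}")
  case True
  then show ?thesis by (simp add: holomorphic_Cn_on_def)
next
  case False
  then obtain x0 where x0: "x0 \<in> V" by blast
  have VS: "V \<subseteq> S" using V by (meson centre_in_cball less_imp_le subset_iff)
  obtain D where D: "\<And>n z. z \<in> U \<Longrightarrow> (F n has_derivative D n z) (at z)"
      "\<And>n z c h. z \<in> U \<Longrightarrow> D n z (c *s h) = c * D n z h"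
    using F unfolding holomorphic_Cn_on_def by metis
  have lim_at: "(\<lambda>n. F n x) \<longlonglongrightarrow> g x" if "x \<in> S" for x
    unfolding lim_sequentially dist_norm using lim that by blast
  have cauchy: "\<exists>N. \<forall>m\<ge>N. \<forall>n\<ge>N. \<forall>x\<in>V. \<forall>h. norm (D m x h - D n x h) \<le> e * norm h"
    if "0 < e" for e
  proof -
    have "0 < e * s / 2" using that \<open>0 < s\<close> by simp
    from lim[OF this] obtain N
      where N: "\<And>n x. n \<ge> N \<Longrightarrow> x \<in> S \<Longrightarrow> norm (F n x - g x) < e * s / 2"
      by blast
    show ?thesis
    proof (intro exI[of _ N] allI impI ballI)
      fix m n x h assume mn: "m \<ge> N" "n \<ge> N" and x: "x \<in> V"
      have xU: "x \<in> U" using x VS \<open>S \<subseteq> U\<close> by auto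
      have "norm (D m x h - D n x h) \<le> e * s / s * norm h"
      proof (rule Cauchy_estimate_Cn[of "\<lambda>z. F m z - F n z" U])
        show "holomorphic_Cn_on (\<lambda>z. F m z - F n z) U" by (intro holomorphic_Cn_on_diff F)
        show "cball x s \<subseteq> U" using V(4)[OF x] \<open>S \<subseteq> U\<close> by auto
        show "((\<lambda>z. F m z - F n z) has_derivative (\<lambda>h. D m x h - D n x h)) (at x)"
          by (intro has_derivative_diff D xU)
        fix y assume "y \<in> cball x s"
        then have "y \<in> S" using V(4)[OF x] by auto
        then show "norm (F m y - F n y) \<le> e * s"
          using N[OF mn(1), of y] N[OF mn(2), of y] norm_triangle_ineq4[of "F m y - g y" "F n y - g y"]
          by simp
      qed (use \<open>0 < s\<close> D(2) xU in \<open>simp_all add: algebra_simps\<close>)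
      then show "norm (D m x h - D n x h) \<le> e * norm h" using \<open>0 < s\<close> by simp
    qed
  qed
  define E where "E x h = lim (\<lambda>n. D n x h)" for x h
  have E: "(\<lambda>n. D n x h) \<longlonglongrightarrow> E x h" if "x \<in> V" for x h
  proof -
    have "Cauchy (\<lambda>n. D n x h)"
    proof (rule CauchyI)
      fix e :: real assume e: "0 < e"
      have pos: "0 < e / (norm h + 1)" using e by (simp add: add_nonneg_pos)
      have "e / (norm h + 1) * norm h < e"
        using e by (simp add: pos_divide_less_eq add_nonneg_pos)
      then show "\<exists>N. \<forall>m\<ge>N. \<forall>n\<ge>N. norm (D m x h - D n x h) < e"
        using cauchy[OF pos] that by (meson order_le_less_trans)
    qed
    then show ?thesis unfolding E_def convergent_LIMSEQ_iff[symmetric] by (rule Cauchy_convergent)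
  qed
  have "\<exists>G. \<forall>x\<in>V. (\<lambda>n. F n x) \<longlonglongrightarrow> G x \<and> (G has_derivative E x) (at x within V)"
  proof (rule has_derivative_sequence[OF \<open>convex V\<close> _ _ x0])
    show "(F n has_derivative D n x) (at x within V)" if "x \<in> V" for n x
      by (rule has_derivative_at_withinI, rule D) (use that VS \<open>S \<subseteq> U\<close> in auto)
    show "(\<lambda>n. F n x0) \<longlonglongrightarrow> g x0" using lim_at x0 VS by auto
    fix e :: real assume "0 < e"
    from cauchy[OF this] obtain N
      where N: "\<And>m n x h. m \<ge> N \<Longrightarrow> n \<ge> N \<Longrightarrow> x \<in> V \<Longrightarrow> norm (D m x h - D n x h) \<le> e * norm h"
      by blast
    have "norm (D m x h - E x h) \<le> e * norm h" if "m \<ge> N" "x \<in> V" for m x h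
    proof (rule LIMSEQ_le_const2)
      show "(\<lambda>n. norm (D m x h - D n x h)) \<longlonglongrightarrow> norm (D m x h - E x h)"
        using E[OF that(2)] by (intro tendsto_intros)
      show "\<exists>N. \<forall>n\<ge>N. norm (D m x h - D n x h) \<le> e * norm h" using N that by blast
    qed
    then show "\<forall>\<^sub>F n in sequentially. \<forall>x\<in>V. \<forall>h. norm (D n x h - E x h) \<le> e * norm h"
      unfolding eventually_sequentially by blast
  qed
  then obtain G where G: "\<And>x. x \<in> V \<Longrightarrow> (\<lambda>n. F n x) \<longlonglongrightarrow> G x"
      "\<And>x. x \<in> V \<Longrightarrow> (G has_derivative E x) (at x within V)"
    by blast
  have "holomorphic_Cn_on G V"
    unfolding holomorphic_Cn_on_def
  proof (intro conjI ballI exI allI)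
    fix x c h assume x: "x \<in> V"
    show "(G has_derivative E x) (at x)"
      using G(2)[OF x] at_within_open[OF x \<open>open V\<close>] by simp
    have "x \<in> U" using x VS \<open>S \<subseteq> U\<close> by auto
    then have "(\<lambda>n. D n x (c *s h)) \<longlonglongrightarrow> c * E x h"
      unfolding D(2)[OF \<open>x \<in> U\<close>] using E[OF x] by (intro tendsto_intros)
    then show "E x (c *s h) = c * E x h" using E[OF x] LIMSEQ_unique by blast
  qed (rule \<open>open V\<close>)
  moreover have "g x = G x" if "x \<in> V" for x
    using G(1)[OF that] lim_at that VS LIMSEQ_unique by blast
  ultimately show ?thesis by (rule holomorphic_Cn_on_cong) 
qed

text \<open>The Cauchy estimate bounds the Lipschitz constants on \<open>cball \<zeta> (r / 2)\<close>, so Arzela-Ascoli gives a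
subsequence that converges uniformly there. A second loss of radius makes the limit holomorphic.
The shrinking radius is harmless later, because only some radius independent of the functions matters.\<close>

lemma Montel_ball:
  fixes F :: "nat \<Rightarrow> complex ^ 'n \<Rightarrow> complex"
  assumes "0 < r" and F: "\<And>n. holomorphic_Cn_on (F n) (ball \<zeta> r)"
    and M: "\<And>n z. z \<in> ball \<zeta> r \<Longrightarrow> norm (F n z) \<le> M"
  obtains g k where "holomorphic_Cn_on g (ball \<zeta> (r / 4))" "strict_mono (k :: nat \<Rightarrow> nat)"
    "\<And>z. z \<in> ball \<zeta> (r / 4) \<Longrightarrow> (\<lambda>n. F (k n) z) \<longlonglongrightarrow> g z"
proof -
  let ?S = "cball \<zeta> (r / 2)"
  have fit: "cball x (r / 4) \<subseteq> ball \<zeta> r" if "x \<in> ?S" for x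
  proof
    fix y assume "y \<in> cball x (r / 4)"
    then show "y \<in> ball \<zeta> r" using that \<open>0 < r\<close> dist_triangle[of \<zeta> y x] by simp
  qed
  have fit': "cball x (r / 4) \<subseteq> ?S" if "x \<in> ball \<zeta> (r / 4)" for x
  proof
    fix y assume "y \<in> cball x (r / 4)"
    then show "y \<in> ?S" using that dist_triangle[of \<zeta> y x] by simp
  qed
  have "0 \<le> M" using M[of \<zeta> 0] \<open>0 < r\<close> norm_ge_zero[of "F 0 \<zeta>"]
    by (meson centre_in_ball order_trans)
  define C where "C = M / (r / 4)"
  have "0 \<le> C" using \<open>0 \<le> M\<close> \<open>0 < r\<close> by (simp add: C_def)
  have lip: "norm (F n x - F n y) \<le> C * norm (x - y)" if "x \<in> ?S" "y \<in> ?S" for n x y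
    unfolding C_def
    by (rule bounded_holomorphic_Lipschitz[OF F convex_cball _ fit M that]) (use \<open>0 < r\<close> in auto)
  obtain g k where k: "strict_mono (k :: nat \<Rightarrow> nat)"
    and lim: "\<And>e. 0 < e \<Longrightarrow> \<exists>N. \<forall>n x. n \<ge> N \<and> x \<in> ?S \<longrightarrow> norm (F (k n) x - g x) < e"
  proof (rule Arzela_Ascoli[of ?S F M])
    show "norm (F n x) \<le> M" if "x \<in> ?S" for n x using that \<open>0 < r\<close> by (intro M) auto
    fix x and e :: real assume x: "x \<in> ?S" and "0 < e"
    show "\<exists>d. 0 < d \<and> (\<forall>n y. y \<in> ?S \<and> norm (x - y) < d \<longrightarrow> norm (F n x - F n y) < e)"
    proof (intro exI[of _ "e / (C + 1)"] conjI allI impI)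
      show "0 < e / (C + 1)" using \<open>0 < e\<close> \<open>0 \<le> C\<close> by simp
      fix n y assume y: "y \<in> ?S \<and> norm (x - y) < e / (C + 1)"
      have "norm (F n x - F n y) \<le> C * norm (x - y)" using lip x y by blast
      also have "\<dots> \<le> C * (e / (C + 1))" using y \<open>0 \<le> C\<close> by (intro mult_left_mono) auto
      also have "\<dots> < e" using \<open>0 < e\<close> \<open>0 \<le> C\<close> by (simp add: field_simps)
      finally show "norm (F n x - F n y) < e" .
    qed
  qed (auto intro: that)
  show thesis
  proof
    show "holomorphic_Cn_on g (ball \<zeta> (r / 4))"
    proof (rule holomorphic_Cn_uniform_limit[of "\<lambda>n. F (k n)" "ball \<zeta> r" _ "r / 4" ?S])
      show "?S \<subseteq> ball \<zeta> r" using \<open>0 < r\<close> by auto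
      show "0 < r / 4" using \<open>0 < r\<close> by simp
      show "cball x (r / 4) \<subseteq> ?S" if "x \<in> ball \<zeta> (r / 4)" for x using that by (rule fit')
      show "\<exists>N. \<forall>n x. n \<ge> N \<and> x \<in> ?S \<longrightarrow> norm (F (k n) x - g x) < e" if "0 < e" for e
        using that by (rule lim)
    qed (auto intro: F)
    show "(\<lambda>n. F (k n) z) \<longlonglongrightarrow> g z" if "z \<in> ball \<zeta> (r / 4)" for z
    proof -
      have "z \<in> ?S" using that \<open>0 < r\<close> by simp
      then show ?thesis using lim unfolding lim_sequentially dist_norm by blast
    qed
  qed fact
qed

section \<open>A complete metric for the space of continuous functions\<close>

lemma cont_seminorm_bounded_by:
  assumes "0 \<le> c" "\<And>z. z \<in> L \<Longrightarrow> norm z \<le> real N \<Longrightarrow> norm (h z) \<le> c"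
  shows "cont_seminorm L N h \<le> c"
  unfolding cont_seminorm_def using assms by (intro cSup_least) auto

lemma bdd_above_cont_seminorm:
  fixes L :: "(complex ^ 'n) set" and h :: "complex ^ 'n \<Rightarrow> complex"
  assumes "closed L" "continuous_on L h"
  shows "bdd_above (insert 0 ((\<lambda>z. norm (h z)) ` {z \<in> L. norm z \<le> real N}))"
proof -
  have eq: "{z \<in> L. norm z \<le> real N} = L \<inter> cball 0 (real N)" by auto
  have "compact {z \<in> L. norm z \<le> real N}"
    unfolding eq using assms(1) by (intro closed_Int_compact compact_cball)
  then have "compact ((\<lambda>z. norm (h z)) ` {z \<in> L. norm z \<le> real N})"
    using assms(2) by (intro compact_continuous_image continuous_on_norm)
      (auto intro: continuous_on_subset)
  then show ?thesis
    by (simp add: compact_imp_bounded bounded_imp_bdd_above)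
qed

lemma norm_le_cont_seminorm:
  assumes "closed L" "continuous_on L h" "z \<in> L" "norm z \<le> real N"
  shows "norm (h z) \<le> cont_seminorm L N h"
  unfolding cont_seminorm_def
  using assms(3,4) by (intro cSup_upper bdd_above_cont_seminorm[OF assms(1,2)]) auto

lemma cont_seminorm_nonneg:
  assumes "closed L" "continuous_on L h"
  shows "0 \<le> cont_seminorm L N h"
  unfolding cont_seminorm_def by (intro cSup_upper bdd_above_cont_seminorm[OF assms]) simp

text \<open>A single distance for the whole family of seminorms: far away from the origin the weight
\<open>1 / (1 + norm z)\<close> caps the contribution of \<open>z\<close>, so closeness in this distance only concerns
large bounded parts of \<open>L\<close>. A supremum of capped differences satisfies the triangle inequality
at sight.\<close>

definition cont_dist ::
    "(complex ^ 'n) set \<Rightarrow> (complex ^ 'n \<Rightarrow> complex) \<Rightarrow> (complex ^ 'n \<Rightarrow> complex) \<Rightarrow> real"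
  where "cont_dist L f g =
    Sup (insert 0 ((\<lambda>z. min (1 / (1 + norm z)) (norm (f z - g z))) ` L))"

lemma bdd_above_cont_dist:
  fixes f g :: "complex ^ 'n \<Rightarrow> complex"
  shows "bdd_above (insert 0 ((\<lambda>z. min (1 / (1 + norm z)) (norm (f z - g z))) ` L))"
proof -
  have "1 / (1 + norm z) \<le> 1 / 1" for z :: "complex ^ 'n"
    by (intro divide_left_mono) (auto simp: add_pos_nonneg)
  then have "min (1 / (1 + norm z)) (norm (f z - g z)) \<le> 1" for z
    by (simp add: min.coboundedI1)
  then show ?thesis by (intro bdd_aboveI[of _ 1]) auto
qed

lemma cont_dist_upper: "z \<in> L \<Longrightarrow> min (1 / (1 + norm z)) (norm (f z - g z)) \<le> cont_dist L f g"
  unfolding cont_dist_def by (rule cSup_upper[OF _ bdd_above_cont_dist]) auto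

lemma cont_dist_nonneg: "0 \<le> cont_dist L f g"
  unfolding cont_dist_def by (rule cSup_upper[OF _ bdd_above_cont_dist]) auto

lemma cont_dist_least:
  assumes "0 \<le> c" "\<And>z. z \<in> L \<Longrightarrow> min (1 / (1 + norm z)) (norm (f z - g z)) \<le> c"
  shows "cont_dist L f g \<le> c"
  unfolding cont_dist_def using assms by (intro cSup_least) auto

lemma cont_dist_le:
  assumes "\<And>z. z \<in> L \<Longrightarrow> norm z \<le> R \<Longrightarrow> norm (f z - g z) \<le> c" and "1 / (1 + R) \<le> c" "0 \<le> R"
  shows "cont_dist L f g \<le> c"
proof (rule cont_dist_least)
  have "0 \<le> 1 / (1 + R)" using \<open>0 \<le> R\<close> by simp
  then show "0 \<le> c" using assms(2) by linarith
  fix z assume z: "z \<in> L"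
  show "min (1 / (1 + norm z)) (norm (f z - g z)) \<le> c"
  proof (cases "norm z \<le> R")
    case True
    then show ?thesis using assms(1) z by (simp add: min.coboundedI2)
  next
    case False
    then have "1 / (1 + norm z) \<le> 1 / (1 + R)" using \<open>0 \<le> R\<close> by (intro divide_left_mono) auto
    then show ?thesis using assms(2) by linarith
  qed
qed

lemma norm_diff_le_cont_dist:
  assumes "cont_dist L f g < 1 / (1 + R)" "z \<in> L" "norm z \<le> R"
  shows "norm (f z - g z) \<le> cont_dist L f g"
proof -
  have "1 / (1 + R) \<le> 1 / (1 + norm z)"
    using assms(3) norm_ge_zero[of z] by (intro divide_left_mono mult_pos_pos) linarith+
  then show ?thesis using cont_dist_upper[OF assms(2), of f g] assms(1) by linarith
qed

lemma Metric_space_cont_dist: "Metric_space (cont_space L) (cont_dist L)"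
proof
  fix f g h
  show "0 \<le> cont_dist L f g" by (rule cont_dist_nonneg)
  show "cont_dist L f g = cont_dist L g f"
    by (simp add: cont_dist_def norm_minus_commute)
  show "(cont_dist L f g = 0) = (f = g)" if "f \<in> cont_space L" "g \<in> cont_space L"
  proof
    assume 0: "cont_dist L f g = 0"
    show "f = g"
    proof (rule extensionalityI[of _ L])
      fix z assume "z \<in> L"
      then show "f z = g z"
        using norm_diff_le_cont_dist[of L f g "norm z" z] 0 by (simp add: add_pos_nonneg)
    qed (use that in \<open>auto simp: cont_space_def\<close>)
  next
    assume "f = g"
    then have "cont_dist L f g \<le> 0" by (intro cont_dist_least) auto
    then show "cont_dist L f g = 0" using cont_dist_nonneg[of L f g] by linarith
  qed
  show "cont_dist L f h \<le> cont_dist L f g + cont_dist L g h"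
  proof (rule cont_dist_least)
    show "0 \<le> cont_dist L f g + cont_dist L g h" by (simp add: cont_dist_nonneg)
    fix z assume "z \<in> L"
    then have "min (1 / (1 + norm z)) (norm (f z - g z)) \<le> cont_dist L f g"
      "min (1 / (1 + norm z)) (norm (g z - h z)) \<le> cont_dist L g h"
      by (auto intro: cont_dist_upper)
    moreover have "norm (f z - h z) \<le> norm (f z - g z) + norm (g z - h z)"
      using norm_triangle_ineq[of "f z - g z" "g z - h z"] by simp
    ultimately show "min (1 / (1 + norm z)) (norm (f z - h z)) \<le> cont_dist L f g + cont_dist L g h"
      using cont_dist_nonneg[of L f g] cont_dist_nonneg[of L g h] norm_ge_zero[of "f z - g z"]
        norm_ge_zero[of "g z - h z"] by linarith
  qed
qed

interpretation cont: Metric_space "cont_space L" "cont_dist L" for L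
  by (rule Metric_space_cont_dist)

lemma continuous_on_cont_space: "f \<in> cont_space L \<Longrightarrow> continuous_on L f"
  by (simp add: cont_space_def)

lemma mtopology_cont_dist:
  assumes "closed L"
  shows "cont.mtopology L = cont_topology L"
proof -
  let ?B = "\<lambda>f N e. {g \<in> cont_space L. cont_seminorm L N (\<lambda>z. g z - f z) < e}"
  have "openin (cont_topology L) S" if S: "openin (cont.mtopology L) S" for S
  proof (subst openin_subopen, intro ballI)
    fix f assume "f \<in> S"
    with S obtain r where r: "0 < r" "cont.mball L f r \<subseteq> S" and f: "f \<in> cont_space L"
      unfolding cont.openin_mtopology by blast
    obtain N :: nat where N: "1 / (1 + real N) < r / 2"
      using nat_approx_posE[of "r / 2"] r(1) by auto
    have "?B f N (r / 2) \<subseteq> S"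
    proof (intro subset_trans[OF _ r(2)] subsetI)
      fix g assume g: "g \<in> ?B f N (r / 2)"
      have "cont_dist L f g \<le> r / 2"
      proof (rule cont_dist_le)
        fix z assume "z \<in> L" "norm z \<le> real N"
        then have "norm (g z - f z) \<le> cont_seminorm L N (\<lambda>z. g z - f z)"
          using g f assms by (intro norm_le_cont_seminorm continuous_on_diff continuous_on_cont_space) auto
        then show "norm (f z - g z) \<le> r / 2" using g by (simp add: norm_minus_commute)
      qed (use N in auto)
      then show "g \<in> cont.mball L f r" using f g r(1) by simp
    qed
    moreover have "openin (cont_topology L) (?B f N (r / 2))"
      unfolding cont_topology_def
    proof (rule topology_generated_by_Basis, rule CollectI, intro exI conjI)
      show "?B f N (r / 2) = ?B f N (r / 2)" ..
    qed (use f r(1) in simp_all)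
    moreover have "f \<in> ?B f N (r / 2)"
      using f r(1) cont_seminorm_bounded_by[of 0 L N "\<lambda>z. f z - f z"] by simp
    ultimately show "\<exists>T. openin (cont_topology L) T \<and> f \<in> T \<and> T \<subseteq> S" by blast
  qed
  moreover have "openin (cont.mtopology L) S" if "openin (cont_topology L) S" for S
  proof -
    have basic: "openin (cont.mtopology L) (?B f N e)" if f: "f \<in> cont_space L" for f N e
      unfolding cont.openin_mtopology
    proof (intro conjI allI impI)
      fix g assume g: "g \<in> ?B f N e"
      \<comment> \<open>Staying below \<open>1 / (1 + N)\<close> switches off the cap for all points of norm at most \<open>N\<close>.\<close>
      define \<delta> where "\<delta> = min ((e - cont_seminorm L N (\<lambda>z. g z - f z)) / 2) (1 / (1 + real N))"
      have \<delta>: "0 < \<delta>" "\<delta> \<le> 1 / (1 + real N)" "cont_seminorm L N (\<lambda>z. g z - f z) + \<delta> < e"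
        using g by (auto simp: \<delta>_def min_def field_simps)
      have nonneg: "0 \<le> cont_seminorm L N (\<lambda>z. g z - f z)"
        using g f assms by (intro cont_seminorm_nonneg continuous_on_diff continuous_on_cont_space) auto
      have "h \<in> ?B f N e" if "h \<in> cont.mball L g \<delta>" for h
      proof -
        have h: "h \<in> cont_space L" "cont_dist L g h < \<delta>" using that by auto
        have "cont_seminorm L N (\<lambda>z. h z - f z) \<le> cont_seminorm L N (\<lambda>z. g z - f z) + \<delta>"
        proof (rule cont_seminorm_bounded_by)
          fix z assume z: "z \<in> L" "norm z \<le> real N"
          have "norm (g z - f z) \<le> cont_seminorm L N (\<lambda>z. g z - f z)"
            using z g f assms by (intro norm_le_cont_seminorm continuous_on_diff continuous_on_cont_space) auto
          moreover have "norm (g z - h z) \<le> cont_dist L g h"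
            using h(2) \<delta>(2) z by (intro norm_diff_le_cont_dist) auto
          moreover have "norm (h z - f z) \<le> norm (g z - h z) + norm (g z - f z)"
            using norm_triangle_ineq4[of "g z - f z" "g z - h z"] by simp
          ultimately show "norm (h z - f z) \<le> cont_seminorm L N (\<lambda>z. g z - f z) + \<delta>"
            using h(2) by linarith
        qed (use nonneg \<delta>(1) in linarith)
        then show ?thesis using h(1) \<delta>(3) by simp
      qed
      then show "\<exists>r>0. cont.mball L g r \<subseteq> ?B f N e" using \<delta>(1) by blast
    qed auto
    have "generate_topology_on {?B f N e | f N e. f \<in> cont_space L \<and> e > 0} S"
      using that unfolding cont_topology_def by (rule openin_topology_generated_by)
    then show ?thesis
    proof induction
      case (Basis s)
      then show ?case using basic by blast
    qed auto
  qed
  ultimately show ?thesis unfolding topology_eq by blast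
qed

lemma limitin_cont_dist_imp_tendsto:
  assumes "limitin (cont.mtopology L) \<sigma> f sequentially" "z \<in> L"
  shows "(\<lambda>n. \<sigma> n z) \<longlonglongrightarrow> f z"
proof (rule tendstoI)
  fix e :: real assume "0 < e"
  define \<delta> where "\<delta> = min e (1 / (1 + norm z))"
  have "0 < \<delta>" using \<open>0 < e\<close> by (simp add: \<delta>_def add_pos_nonneg)
  then have "\<forall>\<^sub>F n in sequentially. \<sigma> n \<in> cont_space L \<and> cont_dist L (\<sigma> n) f < \<delta>"
    using assms(1) unfolding cont.limitin_metric by blast
  then show "\<forall>\<^sub>F n in sequentially. dist (\<sigma> n z) (f z) < e"
  proof eventually_elim
    case (elim n)
    then have "norm (\<sigma> n z - f z) \<le> cont_dist L (\<sigma> n) f"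
      using assms(2) by (intro norm_diff_le_cont_dist[of _ _ _ "norm z"]) (auto simp: \<delta>_def)
    then show ?case using elim by (simp add: dist_norm \<delta>_def)
  qed
qed

text \<open>A Cauchy sequence is uniformly Cauchy on bounded parts of \<open>L\<close>; continuity of the pointwise limit
is local, so uniform convergence on \<open>L \<inter> ball 0 R\<close> suffices for it.\<close>

lemma mcomplete_cont_dist: "Metric_space.mcomplete (cont_space L) (cont_dist L)"
  unfolding cont.mcomplete_def
proof (intro allI impI)
  fix \<sigma> assume "cont.MCauchy L \<sigma>"
  then have *: "range \<sigma> \<subseteq> cont_space L"
      "\<forall>e>0. \<exists>N. \<forall>m n. N \<le> m \<longrightarrow> N \<le> n \<longrightarrow> cont_dist L (\<sigma> m) (\<sigma> n) < e"
    unfolding cont.MCauchy_def by (rule conjunct1, rule conjunct2)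
  have \<sigma>: "\<sigma> n \<in> cont_space L" for n
    using *(1) by blast
  have cauchy: "\<exists>N. \<forall>m\<ge>N. \<forall>n\<ge>N. cont_dist L (\<sigma> m) (\<sigma> n) < e" if "0 < e" for e
    using *(2) that by blast
  have ucauchy: "\<exists>N. \<forall>m\<ge>N. \<forall>n\<ge>N. \<forall>z\<in>L. norm z \<le> R \<longrightarrow> norm (\<sigma> m z - \<sigma> n z) < e"
    if e: "0 < e" and R: "0 \<le> R" for e R :: real
  proof -
    have "0 < min e (1 / (1 + R))" using e R by simp
    from cauchy[OF this] obtain N
      where N: "\<And>m n. m \<ge> N \<Longrightarrow> n \<ge> N \<Longrightarrow> cont_dist L (\<sigma> m) (\<sigma> n) < min e (1 / (1 + R))"
      by blast
    show ?thesis
    proof (intro exI[of _ N] allI impI ballI)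
      fix m n z assume *: "m \<ge> N" "n \<ge> N" "z \<in> L" "norm z \<le> R"
      have "norm (\<sigma> m z - \<sigma> n z) \<le> cont_dist L (\<sigma> m) (\<sigma> n)"
        using N[OF *(1,2)] * by (intro norm_diff_le_cont_dist[of _ _ _ R]) auto
      then show "norm (\<sigma> m z - \<sigma> n z) < e" using N[OF *(1,2)] by linarith
    qed
  qed
  define f where "f = restrict (\<lambda>z. lim (\<lambda>n. \<sigma> n z)) L"
  have lim: "(\<lambda>n. \<sigma> n z) \<longlonglongrightarrow> f z" if "z \<in> L" for z
  proof -
    have "Cauchy (\<lambda>n. \<sigma> n z)"
      using ucauchy[of _ "norm z"] that by (intro CauchyI) (metis norm_ge_zero order_refl)
    then show ?thesis using that by (simp add: f_def Cauchy_convergent convergent_LIMSEQ_iff[symmetric])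
  qed
  have unif: "\<exists>N. \<forall>n\<ge>N. \<forall>z\<in>L. norm z \<le> R \<longrightarrow> norm (\<sigma> n z - f z) \<le> e"
    if "0 < e" "0 \<le> R" for e R
  proof -
    from ucauchy[OF that] obtain N
      where N: "\<And>m n z. m \<ge> N \<Longrightarrow> n \<ge> N \<Longrightarrow> z \<in> L \<Longrightarrow> norm z \<le> R \<Longrightarrow> norm (\<sigma> m z - \<sigma> n z) < e"
      by blast
    have "norm (\<sigma> m z - f z) \<le> e" if "m \<ge> N" "z \<in> L" "norm z \<le> R" for m z
    proof (rule LIMSEQ_le_const2)
      show "(\<lambda>n. norm (\<sigma> m z - \<sigma> n z)) \<longlonglongrightarrow> norm (\<sigma> m z - f z)"
        using lim[OF that(2)] by (intro tendsto_intros)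
      show "\<exists>N. \<forall>n\<ge>N. norm (\<sigma> m z - \<sigma> n z) \<le> e" using N that by (meson less_imp_le)
    qed
    then show ?thesis by blast
  qed
  have "continuous_on L f"
    unfolding continuous_on_eq_continuous_within
  proof
    fix z assume z: "z \<in> L"
    define R where "R = norm z + 1"
    have "uniform_limit (L \<inter> ball 0 R) \<sigma> f sequentially"
    proof (rule uniform_limitI)
      fix e :: real assume "0 < e"
      then obtain N where "\<forall>n\<ge>N. \<forall>z\<in>L. norm z \<le> R \<longrightarrow> norm (\<sigma> n z - f z) \<le> e / 2"
        using unif[of "e / 2" R] by (auto simp: R_def)
      then have "\<forall>n\<ge>N. \<forall>z\<in>L \<inter> ball 0 R. dist (\<sigma> n z) (f z) < e"
        using \<open>0 < e\<close> by (fastforce simp: dist_norm)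
      then show "\<forall>\<^sub>F n in sequentially. \<forall>z\<in>L \<inter> ball 0 R. dist (\<sigma> n z) (f z) < e"
        unfolding eventually_sequentially by blast
    qed
    then have "continuous_on (L \<inter> ball 0 R) f"
    proof (rule uniform_limit_theorem[rotated])
      show "\<forall>\<^sub>F n in sequentially. continuous_on (L \<inter> ball 0 R) (\<sigma> n)"
        using continuous_on_cont_space[OF \<sigma>] by (intro always_eventually) (auto intro: continuous_on_subset)
    qed simp
    moreover have "z \<in> L \<inter> ball 0 R" using z by (simp add: R_def)
    ultimately have "continuous (at z within L \<inter> ball 0 R) f"
      by (simp add: continuous_on_eq_continuous_within)
    moreover have "at z within L \<inter> ball 0 R = at z within L"
      by (rule at_within_nhd[of z "ball 0 R"]) (auto simp: R_def)
    ultimately show "continuous (at z within L) f" by simp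
  qed
  then have f: "f \<in> cont_space L" by (simp add: cont_space_def f_def)
  have "limitin (cont.mtopology L) \<sigma> f sequentially"
    unfolding cont.limitin_metric
  proof (intro conjI allI impI f)
    fix e :: real assume "0 < e"
    obtain K :: nat where K: "1 / (1 + real K) < e / 2"
      using nat_approx_posE[of "e / 2"] \<open>0 < e\<close> by auto
    obtain N where N: "\<And>n z. n \<ge> N \<Longrightarrow> z \<in> L \<Longrightarrow> norm z \<le> real K \<Longrightarrow> norm (\<sigma> n z - f z) \<le> e / 2"
      using unif[of "e / 2" "real K"] \<open>0 < e\<close> by auto
    have "cont_dist L (\<sigma> n) f < e" if "n \<ge> N" for n
    proof -
      have "cont_dist L (\<sigma> n) f \<le> e / 2"
        using N[OF that] K by (intro cont_dist_le[of _ "real K"]) auto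
      then show ?thesis using \<open>0 < e\<close> by linarith
    qed
    then show "\<forall>\<^sub>F n in sequentially. \<sigma> n \<in> cont_space L \<and> cont_dist L (\<sigma> n) f < e"
      unfolding eventually_sequentially using \<sigma> by blast
  qed
  then show "\<exists>f. limitin (cont.mtopology L) \<sigma> f sequentially" by blast
qed

section \<open>Sets of uniqueness\<close>

text \<open>The hypothesis on products of domains. It makes \<open>L\<close> a set of uniqueness for holomorphic functions.\<close>

definition slice_accumulating :: "(complex ^ 'n) set \<Rightarrow> bool"
  where "slice_accumulating L \<longleftrightarrow>
    (\<forall>U :: 'n \<Rightarrow> complex set. (\<forall>i. open (U i) \<and> connected (U i) \<and> U i \<noteq> {}) \<longrightarrow>
        (\<forall>z \<in> {z. \<forall>i. z $ i \<in> U i} \<inter> L. \<forall>i. \<exists>p\<in>U i.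
          p islimpt {w \<in> U i. (\<chi> j. if j = i then w else z $ j) \<in> L}))"

text \<open>The hypothesis on small balls. At a point \<open>\<zeta>\<close> that is not interior to \<open>L\<close>, the hyperplane is the
pole set of a function that is continuous on \<open>L\<close> near \<open>\<zeta>\<close> but blows up at \<open>w\<close>.\<close>

definition hyperplane_avoidable :: "(complex ^ 'n) set \<Rightarrow> bool"
  where "hyperplane_avoidable L \<longleftrightarrow>
    (\<forall>\<zeta>\<in>L. \<exists>r0>0. ball \<zeta> r0 \<subseteq> L \<or>
        (\<forall>r. 0 < r \<and> r < r0 \<longrightarrow>
          (\<exists>w\<in>ball \<zeta> r - L. \<exists>H. complex_hyperplane H \<and> w \<in> H \<and> H \<inter> (ball \<zeta> r \<inter> L) = {})))"

text \<open>The coordinates of a point of \<open>L\<close> are freed one at a time. Suppose that \<open>G\<close> vanishes when the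
coordinates in \<open>S\<close> are arbitrary and the others come from any point of \<open>L\<close>. As a function of the
\<open>k\<close>-th coordinate alone, \<open>G\<close> is then zero for all values that keep the point in \<open>L\<close>; these accumulate
in \<open>U k\<close>, so it is zero identically. The claim has to be quantified over all points of \<open>L\<close>,
since the step changes the base point.\<close>

lemma vanishes_on_polydomain:
  fixes G :: "complex ^ 'n \<Rightarrow> complex"
  assumes acc: "slice_accumulating L"
    and G: "holomorphic_Cn_on G W"
    and U: "\<And>i. open (U i)" "\<And>i. connected (U i)" and UW: "{w. \<forall>i. w $ i \<in> U i} \<subseteq> W"
    and zero: "\<And>z. z \<in> L \<Longrightarrow> (\<And>i. z $ i \<in> U i) \<Longrightarrow> G z = 0"
    and z: "z \<in> L" "\<And>i. z $ i \<in> U i" and w: "\<And>i. w $ i \<in> U i"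
  shows "G w = 0"
proof -
  have "\<forall>z w. z \<in> L \<longrightarrow> (\<forall>i. z $ i \<in> U i) \<longrightarrow> (\<forall>i. w $ i \<in> U i) \<longrightarrow>
      G (\<chi> i. if i \<in> S then w $ i else z $ i) = 0" for S :: "'n set"
    using finite[of S]
  proof (induction S)
    case empty
    then show ?case using zero by (simp add: vec_nth_inverse)
  next
    case (insert k S)
    show ?case
    proof (intro allI impI)
      fix z w assume z: "z \<in> L" "\<forall>i. z $ i \<in> U i" and w: "\<forall>i. w $ i \<in> U i"
      let ?T = "{t \<in> U k. (\<chi> j. if j = k then t else z $ j) \<in> L}"
      have "\<forall>i. open (U i) \<and> connected (U i) \<and> U i \<noteq> {}" using U z(2) by blast
      from acc[unfolded slice_accumulating_def, THEN spec, THEN mp, OF this, THEN bspec, of z]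
      obtain p where p: "p \<in> U k" "p islimpt ?T" using z by blast
      define v where "v = (\<chi> i. if i \<in> S then w $ i else if i = k then 0 else z $ i)"
      have v: "v + t *s axis k 1 = (\<chi> i. if i \<in> S then w $ i else if i = k then t else z $ i)" for t
        using insert.hyps(2) by (simp add: vec_eq_iff v_def axis_def)
      have "G (v + (w $ k) *s axis k 1) = 0"
      proof (rule analytic_continuation[of "\<lambda>t. G (v + t *s axis k 1)" "U k" ?T p])
        show "(\<lambda>t. G (v + t *s axis k 1)) holomorphic_on U k"
          using z w UW by (intro holomorphic_on_complex_line[OF G]) (auto simp: v)
        show "G (v + t *s axis k 1) = 0" if t: "t \<in> ?T" for t
        proof -
          let ?z = "\<chi> j. if j = k then t else z $ j"
          have "G (\<chi> i. if i \<in> S then w $ i else ?z $ i) = 0"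
            using t z w insert.IH by auto
          then show ?thesis unfolding v by (simp only: vec_lambda_beta)
        qed
      qed (use U p w in auto)
      also have "v + (w $ k) *s axis k 1 = (\<chi> i. if i \<in> insert k S then w $ i else z $ i)"
        by (simp add: v vec_eq_iff)
      finally show "G (\<chi> i. if i \<in> insert k S then w $ i else z $ i) = 0" .
    qed
  qed
  from this[of UNIV] z w show ?thesis by (simp add: vec_nth_inverse)
qed

text \<open>Near \<open>\<zeta>\<close> a polydisc fits into the ball, and there \<open>G\<close> vanishes. The ball itself is not a polydisc;
its other points are reached along the complex line through \<open>\<zeta>\<close>.\<close>

lemma identity_theorem_ball:
  fixes G :: "complex ^ 'n \<Rightarrow> complex"
  assumes acc: "slice_accumulating L" and "\<zeta> \<in> L"
    and G: "holomorphic_Cn_on G (ball \<zeta> r)"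
    and zero: "\<And>z. z \<in> L \<inter> ball \<zeta> r \<Longrightarrow> G z = 0"
    and w: "w \<in> ball \<zeta> r"
  shows "G w = 0"
proof -
  have "0 < r" using w by (metis ball_empty empty_iff linorder_not_less)
  then obtain A where A: "\<And>i. open (A i)" "\<And>i. \<zeta> $ i \<in> A i"
      and AW: "\<And>y. (\<And>i. y $ i \<in> A i) \<Longrightarrow> y \<in> ball \<zeta> r"
    using open_ball[of \<zeta> r] unfolding open_vec_def by (metis centre_in_ball)
  have "\<exists>e>0. ball (\<zeta> $ i) e \<subseteq> A i" for i
    using A open_contains_ball by blast
  then obtain e where e: "\<And>i. 0 < e i" "\<And>i. ball (\<zeta> $ i) (e i) \<subseteq> A i"
    by metis
  let ?P = "{y. \<forall>i. y $ i \<in> ball (\<zeta> $ i) (e i)}"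
  have P: "?P \<subseteq> ball \<zeta> r" using AW e(2) by blast
  have vanish: "G y = 0" if "y \<in> ?P" for y
  proof (rule vanishes_on_polydomain[OF acc G, of "\<lambda>i. ball (\<zeta> $ i) (e i)" \<zeta>])
    show "{w. \<forall>i. w $ i \<in> ball (\<zeta> $ i) (e i)} \<subseteq> ball \<zeta> r" by (rule P)
    show "G z = 0" if "z \<in> L" "\<And>i. z $ i \<in> ball (\<zeta> $ i) (e i)" for z
      using that P by (intro zero) blast
  qed (use that e \<open>\<zeta> \<in> L\<close> in auto)
  have "open ?P"
    unfolding open_vec_def
    by (intro ballI exI[of _ "\<lambda>i. ball (\<zeta> $ i) (e i)"]) auto
  let ?l = "\<lambda>t. \<zeta> + t *s (w - \<zeta>)"
  let ?Q = "?l -` ball \<zeta> r"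
  have cont: "continuous_on UNIV ?l"
    by (intro continuous_intros linear_continuous_on bounded_linear_complex_line)
  have "G (?l 1) = 0"
  proof (rule analytic_continuation[of "\<lambda>t. G (?l t)" ?Q "?l -` ?P" 0])
    show "(\<lambda>t. G (?l t)) holomorphic_on ?Q" by (intro holomorphic_on_complex_line[OF G]) auto
    show "open ?Q" using cont by (rule open_vimage[OF open_ball])
    have "convex ?Q"
    proof -
      have "linear (\<lambda>t. t *s (w - \<zeta>))"
        using bounded_linear_complex_line by (rule bounded_linear.linear)
      moreover have "?Q = (\<lambda>t. t *s (w - \<zeta>)) -` ball 0 r"
        by (auto simp: dist_norm)
      ultimately show ?thesis by (simp add: convex_linear_vimage)
    qed
    then show "connected ?Q" by (rule convex_connected)
    show "?l -` ?P \<subseteq> ?Q" by (rule vimage_mono[OF P])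
    show "0 islimpt ?l -` ?P"
      using open_vimage[OF \<open>open ?P\<close> cont] e(1)
      by (intro interior_limit_point) (simp add: interior_open)
  qed (use vanish w \<open>0 < r\<close> in auto)
  then show ?thesis by simp
qed

text \<open>The functional is the last coordinate with respect to a basis of \<open>complex ^ 'n\<close> that extends a
basis of the direction space of \<open>H\<close> by one vector.\<close>

lemma hyperplane_functional:
  fixes H :: "(complex ^ 'n) set"
  assumes "complex_hyperplane H" "w \<in> H"
  obtains l where "\<And>x y. l (x + y) = l x + l y" "\<And>c x. l (c *s x) = c * l x"
    "\<And>z. l (z - w) = 0 \<Longrightarrow> z \<in> H"
proof -
  obtain p V where V: "vec.subspace V" "vec.dim V = CARD('n) - 1" "H = (\<lambda>v. p + v) ` V"
    using assms(1) unfolding complex_hyperplane_def by blast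
  obtain B where B: "B \<subseteq> V" "vec.independent B" "V \<subseteq> vec.span B" "card B = vec.dim V"
    by (rule vec.basis_exists)
  have span: "vec.span B = V"
    using B V(1) vec.span_minimal by blast
  have "V \<noteq> UNIV"
  proof
    assume "V = UNIV"
    then have "vec.dim V = CARD('n)" by (simp add: card_cart_basis)
    with V(2) zero_less_card_finite[where 'a = 'n] show False by linarith
  qed
  then obtain a where a: "a \<notin> V" by blast
  let ?B = "insert a B"
  have ind: "vec.independent ?B" using a B(2) span by (simp add: vec.independent_insert)
  have fin: "finite B" using B(2) by (rule vec.finiteI_independent)
  have "card ?B = CARD('n)" using a B V(2) fin by (auto simp: card_insert_if)
  then have spanB: "vec.span ?B = UNIV"
    using vec.card_ge_dim_independent[OF subset_UNIV ind] by (auto simp: card_cart_basis)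
  define l where "l x = vec.representation ?B x a" for x
  show thesis
  proof
    show "l (x + y) = l x + l y" for x y
      unfolding l_def by (simp add: vec.representation_add[OF ind] spanB)
    show "l (c *s x) = c * l x" for c x
      unfolding l_def by (simp add: vec.representation_scale[OF ind] spanB)
    fix z assume "l (z - w) = 0"
    moreover have "(\<Sum>b\<in>?B. vec.representation ?B (z - w) b *s b) = z - w"
      using fin by (intro vec.sum_representation_eq[OF ind]) (auto simp: spanB)
    ultimately have "(\<Sum>b\<in>B. vec.representation ?B (z - w) b *s b) = z - w"
      using a B(1) fin unfolding l_def by (subst (asm) sum.insert) auto
    moreover have "(\<Sum>b\<in>B. vec.representation ?B (z - w) b *s b) \<in> V"
      using B(1) V(1) by (intro vec.subspace_sum vec.subspace_scale) auto
    ultimately have "z - w \<in> V" by simp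
    moreover obtain v where v: "v \<in> V" "w = p + v" using assms(2) V(3) by blast
    ultimately have "v + (z - w) \<in> V" using V(1) vec.subspace_add by blast
    moreover have "z = p + (v + (z - w))" using v by simp
    ultimately show "z \<in> H" using V(3) by blast
  qed
qed

lemma bounded_linear_complex_functional:
  fixes l :: "complex ^ 'n \<Rightarrow> complex"
  assumes "\<And>x y. l (x + y) = l x + l y" "\<And>c x. l (c *s x) = c * l x"
  shows "bounded_linear l"
proof -
  have "linear l"
  proof (rule linearI)
    fix c and x :: "complex ^ 'n"
    have eq: "c *\<^sub>R x = complex_of_real c *s x" 
      unfolding vec_eq_iff vector_smult_component vector_scaleR_component
      by (simp add: scaleR_conv_of_real)
    show "l (c *\<^sub>R x) = c *\<^sub>R l x"
      unfolding eq assms(2) by (rule scaleR_conv_of_real[symmetric])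
  qed (rule assms(1))
  then show ?thesis by (simp add: linear_conv_bounded_linear)
qed

section \<open>Continuous functions without holomorphic extension\<close>

definition extends_to ::
    "(complex ^ 'n) set \<Rightarrow> (complex ^ 'n \<Rightarrow> complex) \<Rightarrow> (complex ^ 'n) set \<Rightarrow> bool"
  where "extends_to L f U \<longleftrightarrow> (\<exists>F. holomorphic_Cn_on F U \<and> (\<forall>z\<in>U \<inter> L. F z = f z))"

text \<open>If \<open>L\<close> contains a neighbourhood of \<open>\<zeta>\<close>, an extension is the function itself near \<open>\<zeta>\<close>, and
conjugation of a coordinate is not complex differentiable.\<close>

lemma cnj_not_extends_to:
  assumes "ball \<zeta> r \<subseteq> L" "0 < r" "0 < \<rho>"
  shows "\<not> extends_to L (restrict (\<lambda>z. cnj (z $ i)) L) (ball \<zeta> \<rho>)"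
proof
  assume "extends_to L (restrict (\<lambda>z. cnj (z $ i)) L) (ball \<zeta> \<rho>)"
  then obtain F where F: "holomorphic_Cn_on F (ball \<zeta> \<rho>)"
      "\<And>z. z \<in> ball \<zeta> \<rho> \<inter> L \<Longrightarrow> F z = cnj (z $ i)"
    unfolding extends_to_def by auto
  then obtain D where D: "(F has_derivative D) (at \<zeta>)" "\<And>c h. D (c *s h) = c * D h"
    using \<open>0 < \<rho>\<close> unfolding holomorphic_Cn_on_def by (meson centre_in_ball)
  have "((\<lambda>z. cnj (z $ i)) has_derivative D) (at \<zeta>)"
    using F(2) assms
    by (intro has_derivative_transform_within_open[OF D(1), of "ball \<zeta> (min r \<rho>)"]) auto
  moreover have "((\<lambda>z. cnj (z $ i)) has_derivative (\<lambda>h. cnj (h $ i))) (at \<zeta>)"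
    by (intro bounded_linear_imp_has_derivative
        bounded_linear_compose[OF bounded_linear_cnj bounded_linear_vec_nth])
  ultimately have "D = (\<lambda>h. cnj (h $ i))" by (rule has_derivative_unique)
  then show False using D(2)[of \<i> "axis i 1"] by (simp add: axis_def)
qed

text \<open>The function is \<open>1 / l (z - w)\<close> near \<open>\<zeta>\<close>, where \<open>l (z - w)\<close> vanishes only on \<open>H\<close>. An extension \<open>F\<close>
would satisfy \<open>F z * l (z - w) = 1\<close> on \<open>L\<close> near \<open>\<zeta>\<close>, hence at \<open>w\<close> by the identity theorem,
where the left side is \<open>0\<close>.\<close>

lemma not_extends_to_past_hyperplane:
  fixes L :: "(complex ^ 'n) set"
  assumes "closed L" and acc: "slice_accumulating L" and "\<zeta> \<in> L" and "r \<le> \<rho>"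
    and w: "w \<in> ball \<zeta> r" and H: "complex_hyperplane H" "w \<in> H" "H \<inter> (ball \<zeta> r \<inter> L) = {}"
  shows "\<exists>h\<in>cont_space L. \<not> extends_to L h (ball \<zeta> \<rho>)"
proof -
  \<comment> \<open>A slightly smaller closed ball, still around \<open>w\<close>, leaves room for a continuous extension to all of \<open>L\<close>.\<close>
  obtain s where s: "dist \<zeta> w < s" "s < r" using w dense by auto
  obtain l where l: "\<And>x y. l (x + y) = l x + l y" "\<And>c x. l (c *s x) = c * l x"
      "\<And>z. l (z - w) = 0 \<Longrightarrow> z \<in> H"
    using hyperplane_functional[OF H(1,2)] by metis
  interpret l: bounded_linear l by (rule bounded_linear_complex_functional[OF l(1,2)])
  have l_ne: "l (z - w) \<noteq> 0" if "z \<in> L \<inter> cball \<zeta> s" for z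
    using l(3)[of z] H(3) that s by auto
  have "continuous_on (L \<inter> cball \<zeta> s) (\<lambda>z. 1 / l (z - w))"
    using l_ne by (intro continuous_intros l.continuous_on) auto
  moreover have "closedin (top_of_set UNIV) (L \<inter> cball \<zeta> s)"
    using \<open>closed L\<close> by (simp add: closed_Int)
  ultimately obtain g where g: "continuous_on UNIV g" "\<And>z. z \<in> L \<inter> cball \<zeta> s \<Longrightarrow> g z = 1 / l (z - w)"
    by (rule Tietze_unbounded) blast
  have "\<not> extends_to L (restrict g L) (ball \<zeta> \<rho>)"
  proof
    assume "extends_to L (restrict g L) (ball \<zeta> \<rho>)"
    then obtain F where F: "holomorphic_Cn_on F (ball \<zeta> \<rho>)"
        "\<And>z. z \<in> ball \<zeta> \<rho> \<inter> L \<Longrightarrow> F z = g z"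
      unfolding extends_to_def by auto
    have "holomorphic_Cn_on (\<lambda>z. l (z - w)) (ball \<zeta> s)"
      unfolding holomorphic_Cn_on_def
    proof (intro conjI ballI exI allI)
      show "((\<lambda>z. l (z - w)) has_derivative l) (at z)" for z
        using l.has_derivative[OF has_derivative_diff[OF has_derivative_ident has_derivative_const]]
        by simp
    qed (auto simp: l)
    moreover have "holomorphic_Cn_on F (ball \<zeta> s)"
      using s \<open>r \<le> \<rho>\<close> by (intro holomorphic_Cn_on_subset[OF F(1)]) auto
    ultimately have "holomorphic_Cn_on (\<lambda>z. F z * l (z - w) - 1) (ball \<zeta> s)"
      by (intro holomorphic_Cn_on_diff holomorphic_Cn_on_mult holomorphic_Cn_on_const open_ball)
    then have "F w * l (w - w) - 1 = 0"
    proof (rule identity_theorem_ball[OF acc \<open>\<zeta> \<in> L\<close>])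
      fix z assume "z \<in> L \<inter> ball \<zeta> s"
      then show "F z * l (z - w) - 1 = 0"
        using F(2)[of z] g(2)[of z] l_ne[of z] s \<open>r \<le> \<rho>\<close> by simp
    qed (use s in auto)
    then show False by (simp add: l.zero)
  qed
  moreover have "restrict g L \<in> cont_space L"
    using g(1) by (auto simp: cont_space_def intro: continuous_on_subset)
  ultimately show ?thesis by blast
qed

lemma exists_not_extends_to:
  fixes L :: "(complex ^ 'n) set"
  assumes "closed L" "hyperplane_avoidable L" "slice_accumulating L" "\<zeta> \<in> L" "0 < \<rho>"
  shows "\<exists>h\<in>cont_space L. \<not> extends_to L h (ball \<zeta> \<rho>)"
proof -
  obtain r0 where "0 < r0" and r0: "ball \<zeta> r0 \<subseteq> L \<or>
        (\<forall>r. 0 < r \<and> r < r0 \<longrightarrow>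
          (\<exists>w\<in>ball \<zeta> r - L. \<exists>H. complex_hyperplane H \<and> w \<in> H \<and> H \<inter> (ball \<zeta> r \<inter> L) = {}))"
    using assms unfolding hyperplane_avoidable_def by blast
  from r0 show ?thesis
  proof
    assume "ball \<zeta> r0 \<subseteq> L"
    moreover have "restrict (\<lambda>z. cnj (z $ i)) L \<in> cont_space L" for i
      by (auto simp: cont_space_def intro!: continuous_intros)
    ultimately show ?thesis using cnj_not_extends_to \<open>0 < r0\<close> \<open>0 < \<rho>\<close> by blast
  next
    assume *: "\<forall>r. 0 < r \<and> r < r0 \<longrightarrow>
      (\<exists>w\<in>ball \<zeta> r - L. \<exists>H. complex_hyperplane H \<and> w \<in> H \<and> H \<inter> (ball \<zeta> r \<inter> L) = {})"
    define r where "r = min \<rho> (r0 / 2)"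
    have "0 < r" "r < r0" "r \<le> \<rho>" using \<open>0 < r0\<close> \<open>0 < \<rho>\<close> by (auto simp: r_def)
    with * obtain w H where "w \<in> ball \<zeta> r" "complex_hyperplane H" "w \<in> H" "H \<inter> (ball \<zeta> r \<inter> L) = {}"
      by blast
    with assms \<open>r \<le> \<rho>\<close> show ?thesis by (intro not_extends_to_past_hyperplane)
  qed
qed

section \<open>Extendable functions form a meagre set\<close>

text \<open>The functions that extend to one fixed open set form a linear space. If it contained a ball around
\<open>f\<close>, it would contain \<open>f\<close> and \<open>f + t h\<close> for some small \<open>t > 0\<close>, hence \<open>h\<close>, for every \<open>h\<close> in \<open>C(L)\<close>.\<close>

lemma interior_extends_to_empty:
  assumes "closed L" and h: "h \<in> cont_space L" "\<not> extends_to L h U"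
    and S: "\<And>f. f \<in> S \<Longrightarrow> extends_to L f U"
  shows "cont.mtopology L interior_of S = {}"
proof (rule ccontr)
  assume "cont.mtopology L interior_of S \<noteq> {}"
  then obtain f e where f: "f \<in> cont_space L" and e: "0 < e" "cont.mball L f e \<subseteq> S"
    unfolding cont.metric_interior_of by blast
  obtain N :: nat where N: "1 / (1 + real N) < e / 2"
    using nat_approx_posE[of "e / 2"] e(1) by auto
  \<comment> \<open>The summand \<open>1\<close> keeps the bound positive, so that it can be divided by.\<close>
  define b where "b = \<bar>cont_seminorm L N h\<bar> + 1"
  have b: "0 < b" by (simp add: b_def)
  have hb: "norm (h z) \<le> b" if "z \<in> L" "norm z \<le> real N" for z
    using norm_le_cont_seminorm[OF \<open>closed L\<close> continuous_on_cont_space[OF h(1)] that]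
    by (simp add: b_def)
  define t where "t = e / 2 / b"
  have t: "0 < t" "t * b = e / 2" using e(1) b by (auto simp: t_def)
  define f' where "f' = restrict (\<lambda>z. f z + of_real t * h z) L"
  have f': "f' \<in> cont_space L"
    using f h(1) by (auto simp: cont_space_def f'_def intro!: continuous_intros)
  have "cont_dist L f f' \<le> e / 2"
  proof (rule cont_dist_le)
    fix z assume "z \<in> L" "norm z \<le> real N"
    then show "norm (f z - f' z) \<le> e / 2"
      using mult_left_mono[OF hb, of z t] t by (simp add: f'_def norm_mult)
  qed (use N in auto)
  then have "f' \<in> cont.mball L f e" "f \<in> cont.mball L f e" using f f' e(1) by auto
  then have "f \<in> S" "f' \<in> S" using e(2) by blast+
  then have "extends_to L f U" "extends_to L f' U" by (auto intro: S)
  then obtain F F' where F: "holomorphic_Cn_on F U" "\<And>z. z \<in> U \<inter> L \<Longrightarrow> F z = f z"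
    and F': "holomorphic_Cn_on F' U" "\<And>z. z \<in> U \<inter> L \<Longrightarrow> F' z = f' z"
    unfolding extends_to_def by blast
  have "open U" using F(1) by (simp add: holomorphic_Cn_on_def)
  then have "holomorphic_Cn_on (\<lambda>z. of_real (1 / t) * (F' z - F z)) U"
    by (intro holomorphic_Cn_on_mult holomorphic_Cn_on_const holomorphic_Cn_on_diff F F')
  moreover have "of_real (1 / t) * (F' z - F z) = h z" if "z \<in> U \<inter> L" for z
    using F(2)[OF that] F'(2)[OF that] that t(1) by (simp add: f'_def)
  ultimately have "extends_to L h U" unfolding extends_to_def by blast
  with h(2) show False ..
qed

text \<open>One index \<open>m\<close> serves both as bound and, inverted, as radius, so that these sets for all \<open>m\<close>
exhaust the functions that are extendable at \<open>\<zeta>\<close>. The bound is what makes Montel applicable.\<close>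

definition bounded_extendable :: "(complex ^ 'n) set \<Rightarrow> complex ^ 'n \<Rightarrow> nat \<Rightarrow> (complex ^ 'n \<Rightarrow> complex) set"
  where "bounded_extendable L \<zeta> m = {f \<in> cont_space L. \<exists>F.
    holomorphic_Cn_on F (ball \<zeta> (1 / Suc m)) \<and> (\<forall>z\<in>ball \<zeta> (1 / Suc m). norm (F z) \<le> m) \<and>
    (\<forall>z\<in>ball \<zeta> (1 / Suc m) \<inter> L. F z = f z)}"

text \<open>Extensions of an approximating sequence are uniformly bounded, so a subsequence converges to a
holomorphic function, which agrees with the limit on \<open>L\<close>. Thus passing to the closure costs
the bound and a factor in the radius, but not extendability.\<close>

lemma closure_bounded_extendable:
  assumes "f \<in> cont.mtopology L closure_of bounded_extendable L \<zeta> m"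
  shows "extends_to L f (ball \<zeta> (1 / Suc m / 4))"
proof -
  from assms obtain \<sigma> where \<sigma>: "\<And>n. \<sigma> n \<in> bounded_extendable L \<zeta> m"
    and lim: "limitin (cont.mtopology L) \<sigma> f sequentially"
    unfolding cont.closure_of_sequentially by blast
  have "\<forall>n. \<exists>F. holomorphic_Cn_on F (ball \<zeta> (1 / Suc m)) \<and>
      (\<forall>z\<in>ball \<zeta> (1 / Suc m). norm (F z) \<le> m) \<and> (\<forall>z\<in>ball \<zeta> (1 / Suc m) \<inter> L. F z = \<sigma> n z)"
    using \<sigma> unfolding bounded_extendable_def by blast
  from choice[OF this] obtain F where F: "\<And>n. holomorphic_Cn_on (F n) (ball \<zeta> (1 / Suc m))"
      "\<And>n z. z \<in> ball \<zeta> (1 / Suc m) \<Longrightarrow> norm (F n z) \<le> m"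
      "\<And>n z. z \<in> ball \<zeta> (1 / Suc m) \<inter> L \<Longrightarrow> F n z = \<sigma> n z"
    by blast
  obtain g k where g: "holomorphic_Cn_on g (ball \<zeta> (1 / Suc m / 4))" and k: "strict_mono (k :: nat \<Rightarrow> nat)"
    and Fg: "\<And>z. z \<in> ball \<zeta> (1 / Suc m / 4) \<Longrightarrow> (\<lambda>n. F (k n) z) \<longlonglongrightarrow> g z"
  proof (rule Montel_ball[of "1 / Suc m" F \<zeta> "real m"])
    show "0 < 1 / real (Suc m)" by simp
  qed (use F in blast)+
  have "g z = f z" if "z \<in> ball \<zeta> (1 / Suc m / 4) \<inter> L" for z
  proof -
    have "z \<in> ball \<zeta> (1 / Suc m) \<inter> L"
      using that by (auto elim!: less_le_trans simp: field_simps)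
    then have "(\<lambda>n. \<sigma> (k n) z) \<longlonglongrightarrow> g z" using Fg[of z] F(3) that by simp
    moreover have "(\<lambda>n. \<sigma> (k n) z) \<longlonglongrightarrow> f z"
      using LIMSEQ_subseq_LIMSEQ[OF limitin_cont_dist_imp_tendsto[OF lim] k] that by (simp add: o_def)
    ultimately show ?thesis by (rule LIMSEQ_unique)
  qed
  with g show ?thesis unfolding extends_to_def by blast
qed

lemma extends_to_imp_extendable:
  "extends_to L f (ball \<zeta> r) \<Longrightarrow> 0 < r \<Longrightarrow> holomorphically_extendable_at L f \<zeta>"
  unfolding extends_to_def holomorphically_extendable_at_def by (meson centre_in_ball open_ball)

lemma extendable_imp_bounded_extendable:
  assumes "f \<in> cont_space L" "holomorphically_extendable_at L f \<zeta>"
  obtains m where "f \<in> bounded_extendable L \<zeta> m"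
proof -
  obtain U F where U: "open U" "\<zeta> \<in> U" and F: "holomorphic_Cn_on F U" "\<forall>z\<in>U \<inter> L. F z = f z"
    using assms(2) unfolding holomorphically_extendable_at_def by blast
  have "continuous (at \<zeta>) F"
    using F(1) U(2) has_derivative_continuous unfolding holomorphic_Cn_on_def by blast
  then obtain d where d: "0 < d" "\<And>z. dist z \<zeta> < d \<Longrightarrow> dist (F z) (F \<zeta>) < 1"
    unfolding continuous_at_eps_delta by (metis zero_less_one)
  obtain e where e: "0 < e" "ball \<zeta> e \<subseteq> U" using U open_contains_ball by blast
  obtain m1 :: nat where m1: "1 / Suc m1 < min d e" using nat_approx_posE[of "min d e"] d e by auto
  obtain m2 :: nat where m2: "norm (F \<zeta>) + 1 \<le> m2" using real_arch_simple by blast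
  define m where "m = max m1 m2"
  have "1 / Suc m \<le> 1 / Suc m1" by (intro divide_left_mono) (auto simp: m_def)
  then have small: "ball \<zeta> (1 / Suc m) \<subseteq> ball \<zeta> d \<inter> ball \<zeta> e" using m1 by auto
  have "norm (F z) \<le> m" if "z \<in> ball \<zeta> (1 / Suc m)" for z
  proof -
    have "z \<in> ball \<zeta> d" using small that by blast
    then have "norm (F z - F \<zeta>) < 1" using d(2)[of z] by (simp add: dist_norm norm_minus_commute)
    moreover have "norm (F z) \<le> norm (F \<zeta>) + norm (F z - F \<zeta>)" by (rule norm_triangle_sub)
    moreover have "real m2 \<le> real m" by (simp add: m_def)
    ultimately show ?thesis using m2 by linarith
  qed
  moreover have "holomorphic_Cn_on F (ball \<zeta> (1 / Suc m))"
    using small e(2) by (intro holomorphic_Cn_on_subset[OF F(1)]) auto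
  moreover have "\<forall>z\<in>ball \<zeta> (1 / Suc m) \<inter> L. F z = f z" using F(2) small e(2) by blast
  ultimately have "f \<in> bounded_extendable L \<zeta> m" using assms(1) unfolding bounded_extendable_def by blast
  then show thesis by (rule that)
qed

lemma dense_gdelta_complement:
  fixes L :: "(complex ^ 'n) set"
  assumes "closed L" "countable \<C>"
    and C: "\<And>C. C \<in> \<C> \<Longrightarrow> closedin (cont.mtopology L) C"
      "\<And>C. C \<in> \<C> \<Longrightarrow> cont.mtopology L interior_of C = {}"
  shows "dense_gdelta_in (cont_topology L) (cont_space L - \<Union>\<C>)"
proof -
  let ?X = "cont.mtopology L"
  let ?G = "(\<lambda>C. cont_space L - C) ` \<C>"
  have G: "openin ?X T \<and> ?X closure_of T = cont_space L" if T: "T \<in> ?G" for T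
  proof -
    obtain C where "C \<in> \<C>" "T = topspace ?X - C" using T by auto
    then show ?thesis using C[of C] closure_of_complement[of ?X C] by (simp add: openin_diff)
  qed
  have eq: "cont_space L - \<Union>\<C> = topspace ?X \<inter> \<Inter>?G" by auto
  have "(countable intersection_of openin ?X) (\<Inter>?G)"
    unfolding intersection_of_def using G \<open>countable \<C>\<close> by (intro exI[of _ ?G]) auto
  then have "gdelta_in ?X (cont_space L - \<Union>\<C>)"
    unfolding gdelta_in_def relative_to_def eq by blast
  moreover have "?X closure_of (cont_space L - \<Union>\<C>) = topspace ?X"
    unfolding eq closure_of_restrict[symmetric]
    using cont.metric_Baire_category[OF mcomplete_cont_dist, of ?G] \<open>countable \<C>\<close> G by simp
  ultimately show ?thesis
    using mtopology_cont_dist[OF \<open>closed L\<close>] by (simp add: dense_gdelta_in_def)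
qed

text \<open>For each \<open>\<zeta>\<close> the extendable functions are exactly the union over \<open>m\<close> of the closures of
\<open>bounded_extendable L \<zeta> m\<close>: the closures add no function that is not extendable, and none of them
has interior, because its members extend to a common ball and some function in \<open>C(L)\<close> does not.\<close>

lemma dense_gdelta_not_extendable_on:
  fixes L :: "(complex ^ 'n) set"
  assumes "closed L" "countable Q"
    and bad: "\<And>\<zeta> \<rho>. \<zeta> \<in> Q \<Longrightarrow> 0 < \<rho> \<Longrightarrow> \<exists>h\<in>cont_space L. \<not> extends_to L h (ball \<zeta> \<rho>)"
  shows "dense_gdelta_in (cont_topology L)
    {f \<in> cont_space L. \<forall>\<zeta>\<in>Q. \<not> holomorphically_extendable_at L f \<zeta>}"
proof -
  let ?C = "\<lambda>(\<zeta>, m). cont.mtopology L closure_of bounded_extendable L \<zeta> m"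
  let ?\<C> = "?C ` (Q \<times> UNIV)"
  have "dense_gdelta_in (cont_topology L) (cont_space L - \<Union>?\<C>)"
  proof (rule dense_gdelta_complement[OF \<open>closed L\<close>])
    show "countable ?\<C>" using \<open>countable Q\<close> by auto
    show "closedin (cont.mtopology L) C" if "C \<in> ?\<C>" for C using that by auto
    show "cont.mtopology L interior_of C = {}" if C': "C \<in> ?\<C>" for C
    proof -
      obtain \<zeta> m where "\<zeta> \<in> Q" and C: "C = ?C (\<zeta>, m)" using C' by auto
      obtain h where "h \<in> cont_space L" "\<not> extends_to L h (ball \<zeta> (1 / Suc m / 4))"
        using bad[OF \<open>\<zeta> \<in> Q\<close>, of "1 / Suc m / 4"] by auto
      then show ?thesis
        unfolding C using closure_bounded_extendable
        by (intro interior_extends_to_empty[OF \<open>closed L\<close>]) auto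
    qed
  qed
  also have "cont_space L - \<Union>?\<C> = {f \<in> cont_space L. \<forall>\<zeta>\<in>Q. \<not> holomorphically_extendable_at L f \<zeta>}"
  proof (intro set_eqI iffI)
    fix f assume f: "f \<in> cont_space L - \<Union>?\<C>"
    have "\<not> holomorphically_extendable_at L f \<zeta>" if "\<zeta> \<in> Q" for \<zeta>
    proof
      assume "holomorphically_extendable_at L f \<zeta>"
      then obtain m where "f \<in> bounded_extendable L \<zeta> m"
        using f extendable_imp_bounded_extendable by blast
      moreover have "bounded_extendable L \<zeta> m \<subseteq> ?C (\<zeta>, m)"
        by (auto intro!: closure_of_subset simp: bounded_extendable_def)
      ultimately show False using f that by blast
    qed
    then show "f \<in> {f \<in> cont_space L. \<forall>\<zeta>\<in>Q. \<not> holomorphically_extendable_at L f \<zeta>}" using f by blast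
  next
    fix f assume f: "f \<in> {f \<in> cont_space L. \<forall>\<zeta>\<in>Q. \<not> holomorphically_extendable_at L f \<zeta>}"
    have "f \<notin> ?C (\<zeta>, m)" if "\<zeta> \<in> Q" for \<zeta> m
      using f that closure_bounded_extendable[of f L \<zeta> m] extends_to_imp_extendable[of L f \<zeta> "1 / Suc m / 4"]
      by auto
    then show "f \<in> cont_space L - \<Union>?\<C>" using f by blast
  qed
  finally show ?thesis .
qed

text \<open>Extendability spreads to the nearby points of \<open>L\<close>. Therefore a countable dense set of points decides
whether a function is extendable somewhere, and the Baire argument applies to the second claim too.\<close>

lemma extendable_at_dense_subset:
  assumes "L \<subseteq> closure Q" "\<zeta> \<in> L" "holomorphically_extendable_at L f \<zeta>"
  shows "\<exists>q\<in>Q. holomorphically_extendable_at L f q"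
proof -
  obtain U F where U: "open U" "\<zeta> \<in> U" "holomorphic_Cn_on F U" "\<forall>z\<in>U \<inter> L. F z = f z"
    using assms(3) unfolding holomorphically_extendable_at_def by blast
  then obtain q where "q \<in> Q" "q \<in> U"
    using assms(1,2) open_Int_closure_eq_empty[of U Q] by blast
  with U show ?thesis unfolding holomorphically_extendable_at_def by blast
qed

lemma generic_nonextendability:
  fixes L :: "(complex ^ 'n) set"
  assumes L: "closed L" "hyperplane_avoidable L" "slice_accumulating L"
  shows "(\<forall>\<zeta>\<in>L. dense_gdelta_in (cont_topology L)
          {f \<in> cont_space L. \<not> holomorphically_extendable_at L f \<zeta>}) \<and>
        dense_gdelta_in (cont_topology L)
          {f \<in> cont_space L. \<forall>\<zeta>\<in>L. \<not> holomorphically_extendable_at L f \<zeta>}"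
proof (intro conjI ballI)
  fix \<zeta> assume "\<zeta> \<in> L"
  then show "dense_gdelta_in (cont_topology L) {f \<in> cont_space L. \<not> holomorphically_extendable_at L f \<zeta>}"
    using dense_gdelta_not_extendable_on[OF L(1), of "{\<zeta>}"] exists_not_extends_to[OF L] by simp
next
  obtain Q where Q: "countable Q" "Q \<subseteq> L" "L \<subseteq> closure Q" by (rule separable)
  have "(\<forall>\<zeta>\<in>L. \<not> holomorphically_extendable_at L f \<zeta>) \<longleftrightarrow> (\<forall>\<zeta>\<in>Q. \<not> holomorphically_extendable_at L f \<zeta>)" for f
    using extendable_at_dense_subset[OF Q(3)] Q(2) by blast
  then show "dense_gdelta_in (cont_topology L)
      {f \<in> cont_space L. \<forall>\<zeta>\<in>L. \<not> holomorphically_extendable_at L f \<zeta>}"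
    using dense_gdelta_not_extendable_on[OF L(1) Q(1)] exists_not_extends_to[OF L] Q(2)
    by (simp add: subset_iff)
qed

text \<open>In dimension one the hyperplanes are the points, so any \<open>w\<close> outside \<open>L\<close> is its own hyperplane.\<close>

lemma hyperplane_avoidable_dim_1:
  fixes L :: "(complex ^ 'n) set"
  assumes "CARD('n) = 1"
  shows "hyperplane_avoidable L"
  unfolding hyperplane_avoidable_def
proof
  fix \<zeta> assume "\<zeta> \<in> L"
  have point: "complex_hyperplane {w :: complex ^ 'n}" for w
    unfolding complex_hyperplane_def
    using assms by (intro exI[of _ w] exI[of _ "{0}"]) (simp add: vec.subspace_single_0)
  show "\<exists>r0>0. ball \<zeta> r0 \<subseteq> L \<or>
        (\<forall>r. 0 < r \<and> r < r0 \<longrightarrow>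
          (\<exists>w\<in>ball \<zeta> r - L. \<exists>H. complex_hyperplane H \<and> w \<in> H \<and> H \<inter> (ball \<zeta> r \<inter> L) = {}))"
  proof (cases "\<exists>r>0. ball \<zeta> r \<subseteq> L")
    case True
    then show ?thesis by blast
  next
    case False
    have "\<exists>w\<in>ball \<zeta> r - L. \<exists>H. complex_hyperplane H \<and> w \<in> H \<and> H \<inter> (ball \<zeta> r \<inter> L) = {}"
      if r: "0 < r" for r
    proof -
      obtain w where w: "w \<in> ball \<zeta> r" "w \<notin> L" using False r by blast
      show ?thesis using w point[of w] by (intro bexI[of _ w] exI[of _ "{w}"]) auto
    qed
    then show ?thesis by (intro exI[of _ 1]) auto
  qed
qed

lemma perfect_imp_slice_accumulating:
  fixes L :: "(complex ^ 'n) set"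
  assumes "CARD('n) = 1" "\<forall>z\<in>L. z islimpt L"
  shows "slice_accumulating L"
  unfolding slice_accumulating_def
proof (intro allI impI ballI)
  fix U :: "'n \<Rightarrow> complex set" and z i
  assume U: "\<forall>i. open (U i) \<and> connected (U i) \<and> U i \<noteq> {}" and z: "z \<in> {z. \<forall>i. z $ i \<in> U i} \<inter> L"
  have i: "j = i" for j :: 'n
    using assms(1) by (metis card_1_singletonE UNIV_I singletonD)
  let ?T = "{w \<in> U i. (\<chi> j. if j = i then w else z $ j) \<in> L}"
  have "(z $ i) islimpt ?T"
  proof (rule islimptI)
    fix V assume V: "z $ i \<in> V" "open V"
    define W where "W = (\<lambda>y :: complex ^ 'n. y $ i) -` (V \<inter> U i)"
    have "open W"
      using V(2) U unfolding W_def by (intro open_vimage_vec_nth) auto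
    moreover have "z \<in> W" using V(1) z by (simp add: W_def)
    ultimately obtain y where y: "y \<in> L" "y \<in> W" "y \<noteq> z"
      using assms(2) z unfolding islimpt_def by blast
    have "(\<chi> j. if j = i then y $ i else z $ j) = y"
      unfolding vec_eq_iff vec_lambda_beta by (metis i)
    moreover have "y $ i \<noteq> z $ i" using y(3) i by (metis vec_eq_iff)
    ultimately show "\<exists>x\<in>?T. x \<in> V \<and> x \<noteq> z $ i"
      using y by (intro bexI[of _ "y $ i"]) (auto simp: W_def)
  qed
  then show "\<exists>p\<in>U i. p islimpt {w \<in> U i. (\<chi> j. if j = i then w else z $ j) \<in> L}"
    using z by blast
qed

theorem theorem11:
  fixes L :: "(complex ^ 'n) set"
  shows
    "(closed L \<and>
      (\<forall>\<zeta>\<in>L. \<exists>r0>0. ball \<zeta> r0 \<subseteq> L \<or>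
        (\<forall>r. 0 < r \<and> r < r0 \<longrightarrow>
          (\<exists>w\<in>ball \<zeta> r - L. \<exists>H. complex_hyperplane H \<and> w \<in> H \<and> H \<inter> (ball \<zeta> r \<inter> L) = {}))) \<and>
      (\<forall>U :: 'n \<Rightarrow> complex set. (\<forall>i. open (U i) \<and> connected (U i) \<and> U i \<noteq> {}) \<longrightarrow>
        (\<forall>z \<in> {z. \<forall>i. z $ i \<in> U i} \<inter> L. \<forall>i. \<exists>p\<in>U i.
          p islimpt {w \<in> U i. (\<chi> j. if j = i then w else z $ j) \<in> L}))
      \<longrightarrow>
        (\<forall>\<zeta>\<in>L. dense_gdelta_in (cont_topology L)
          {f \<in> cont_space L. \<not> holomorphically_extendable_at L f \<zeta>}) \<and>
        dense_gdelta_in (cont_topology L)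
          {f \<in> cont_space L. \<forall>\<zeta>\<in>L. \<not> holomorphically_extendable_at L f \<zeta>})
     \<and>
     (CARD('n) = 1 \<and> closed L \<and> (\<forall>z\<in>L. z islimpt L)
      \<longrightarrow>
        (\<forall>\<zeta>\<in>L. dense_gdelta_in (cont_topology L)
          {f \<in> cont_space L. \<not> holomorphically_extendable_at L f \<zeta>}) \<and>
        dense_gdelta_in (cont_topology L)
          {f \<in> cont_space L. \<forall>\<zeta>\<in>L. \<not> holomorphically_extendable_at L f \<zeta>})"
  using generic_nonextendability[of L]
    hyperplane_avoidable_dim_1[of L] perfect_imp_slice_accumulating[of L]
  unfolding hyperplane_avoidable_def slice_accumulating_def by satx

end
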